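(* Let $\ell,n$ be positive integers and let $M=(m_{ab})$ be an $\ell\times \ell$ real rooted matrix. Let $C=(c_{ij})$ be an $n\times n$ nonnegative real matrix, and suppose there is a partition $\Pi=(\pi_1,\pi_2,\ldots,\pi_\ell)$ of $[n]=\{1,\ldots,n\}$ such that $$\max_{i\in \pi_a} \sum_{j\in \pi_b} c_{ij}\leq m_{ab} \quad \text{and} \quad \max_{i\in \pi_a} \sum_{j=1}^n c_{ij}\leq \sum_{c=1}^\ell m_{ac}$$ for all $1\leq a\leq \ell$ and $1\leq b\leq \ell-1$. Then $\rho(C)\leq \rho_r(M)$. Moreover, let $u=(u_1,\ldots,u_\ell)^T$ be a rooted eigenvector of $M$ for the eigenvalue $\rho_r(M)$. If $C$ is irreducible, then $\rho(C)=\rho_r(M)$ if and only if both of the following hold: (a) if $u_\ell\neq 0$, then $\sum_{j=1}^n c_{ij}=\sum_{c=1}^\ell m_{ac}$ for all $1\leq a\leq \ell$ and all $i\in\pi_a$; (b) $\sum_{j\in\pi_b} c_{ij}=m_{ab}$ for all $1\leq a\leq \ell$, $1\leq b\leq \ell-1$ and $i\in\pi_a$ such that $u_b>u_\ell$.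
   Context: For a real square matrix $C$, $\rho(C)=\max\{|\lambda|:\lambda \text{ an eigenvalue of } C\}$ is its spectral radius, and $\rho_r(C)$ denotes the largest real eigenvalue of $C$ (with $\rho_r(C)=\infty$ if $C$ has no real eigenvalue). A real vector $(v_1,\ldots,v_k)$ is called rooted if $v_i\geq v_k\geq 0$ for all $1\leq i\leq k-1$. A $k\times k$ real matrix $M$ is called rooted if there is a real constant $d$ such that each of the first $k-1$ columns of $M+dI_k$ is a rooted vector and the row-sum vector of $M+dI_k$ (the vector of its row sums) is a rooted vector. Partitions have nonempty parts. *)

theory Defs
  imports
    "Jordan_Normal_Form.Spectral_Radius"
    "HOL-Library.Extended_Real"
    "HOL-Library.Disjoint_Sets"
    "HOL-Combinatorics.Permutations"
begin

text \<open>Matrices and vectors are indexed from 0: the index set \<open>{1, \<dots>, k}\<close> becomes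
  \<open>{0..<k}\<close>, and the distinguished last index \<open>k\<close> becomes \<open>k - 1\<close>.\<close>

text \<open>The eigenvalues of a real matrix relevant for its spectral radius are the complex ones.\<close>

definition real_spectral_radius :: "real mat \<Rightarrow> real" where
  "real_spectral_radius C = spectral_radius (map_mat complex_of_real C)"

definition largest_real_eigenvalue :: "real mat \<Rightarrow> ereal" where
  "largest_real_eigenvalue C =
     (if spectrum C = {} then \<infinity> else ereal (Max (spectrum C)))"

definition rooted_vec :: "real vec \<Rightarrow> bool" where
  "rooted_vec v \<longleftrightarrow>
     (\<forall>i < dim_vec v - 1. v $ i \<ge> v $ (dim_vec v - 1)) \<and> v $ (dim_vec v - 1) \<ge> 0"

definition row_sum_vec :: "real mat \<Rightarrow> real vec" where
  "row_sum_vec M = vec (dim_row M) (\<lambda>i. \<Sum>j<dim_col M. M $$ (i, j))"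

definition rooted_mat :: "real mat \<Rightarrow> bool" where
  "rooted_mat M \<longleftrightarrow> square_mat M \<and>
     (\<exists>d::real. let M' = M + d \<cdot>\<^sub>m 1\<^sub>m (dim_row M) in
        (\<forall>j < dim_row M - 1. rooted_vec (col M' j)) \<and> rooted_vec (row_sum_vec M'))"

definition indexed_partition :: "nat \<Rightarrow> nat \<Rightarrow> (nat \<Rightarrow> nat set) \<Rightarrow> bool" where
  "indexed_partition n l \<pi> \<longleftrightarrow>
     (\<forall>a<l. \<pi> a \<noteq> {}) \<and> disjoint_family_on \<pi> {..<l} \<and> (\<Union>a<l. \<pi> a) = {..<n}"

text \<open>A square matrix is reducible if a simultaneous permutation of its rows and columns makes
  it block upper triangular with two nonempty square diagonal blocks, the first one of size \<open>k\<close>.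
  Every \<open>1 \<times> 1\<close> matrix, including the zero matrix, is irreducible in this sense.\<close>

definition reducible_mat :: "real mat \<Rightarrow> bool" where
  "reducible_mat C \<longleftrightarrow>
     (\<exists>p k. p permutes {..<dim_row C} \<and> 0 < k \<and> k < dim_row C \<and>
        (\<forall>i \<in> {k..<dim_row C}. \<forall>j<k. C $$ (p i, p j) = 0))"

definition irreducible_mat :: "real mat \<Rightarrow> bool" where
  "irreducible_mat C \<longleftrightarrow> square_mat C \<and> \<not> reducible_mat C"

end

theory Submission
  imports Defs
begin

text \<open>
  In the basis \<open>e\<^sub>1, \<dots>, e\<^sub>l\<^sub>-\<^sub>1, (1, \<dots>, 1)\<close> the rooted vectors become the nonnegative orthant, and a
  rooted matrix becomes a matrix \<open>K\<close> with nonnegative off-diagonal entries. The infimum \<open>\<mu>\<close> of all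
  \<open>c\<close> with \<open>K x < c x\<close> for some \<open>x > 0\<close> is an eigenvalue: otherwise the nonnegative solutions of
  \<open>(c - K) y = (1, \<dots>, 1)\<close>, \<open>c > \<mu>\<close>, converge to a solution for \<open>c = \<mu>\<close>, which shows that the infimum
  is attained, whereas the condition on \<open>c\<close> is open. So for every \<open>c\<close> above the largest real
  eigenvalue of \<open>M\<close> there is a positive rooted \<open>v\<close> with \<open>M v \<le> c v\<close>; summation by parts shows that
  its blockwise constant lift \<open>w\<close> satisfies \<open>C w \<le> c w\<close>, whence \<open>\<rho>(C) \<le> c\<close>.

  For the equality case, let \<open>w\<close> be the lift of \<open>u\<close>, so that \<open>C w \<le> r w\<close>, and let \<open>z\<close> consist of the
  absolute values of an eigenvector of \<open>C\<close> for an eigenvalue of modulus \<open>r\<close>, so that \<open>C z \<ge> r z\<close>. For the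
  least \<open>t\<close> with \<open>z \<le> t w\<close> the vector \<open>t w - z\<close> has a zero entry, hence vanishes by
  irreducibility. Thus \<open>C w = r w\<close>, which is equality in every term of the summation by parts.
\<close>

section \<open>Comparison of vectors through ratios of their entries\<close>

text \<open>The least ratio \<open>y i / x i\<close> gives the largest multiple of \<open>x\<close>
  below \<open>y\<close>, which touches \<open>y\<close> at a minimizing index. Applied to the
  negative of a vector, it yields the least multiple of \<open>x\<close> above that vector.\<close>

lemma minimal_ratio:
  fixes x y :: "nat \<Rightarrow> real"
  assumes "n > 0" and "\<And>i. i < n \<Longrightarrow> x i > 0"
  shows "\<exists>t. \<exists>i<n. y i = t * x i \<and> (\<forall>j<n. t * x j \<le> y j)"
proof -
  define t where "t = Min ((\<lambda>i. y i / x i) ` {..<n})"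
  have "t \<in> (\<lambda>i. y i / x i) ` {..<n}"
    unfolding t_def using assms(1) by (intro Min_in) auto
  then obtain i where i: "i < n" "t = y i / x i" by auto
  have "t * x j \<le> y j" if "j < n" for j
  proof -
    have "t \<le> y j / x j" unfolding t_def using that by (intro Min_le) auto
    then show ?thesis using assms(2)[OF that] by (simp add: field_simps)
  qed
  moreover have "y i = t * x i" using i assms(2)[of i] by simp
  ultimately show ?thesis using i(1) by blast
qed

text \<open>A minimum principle. If \<open>y\<close> had a negative entry, the largest multiple
  \<open>t * x\<close> below \<open>y\<close> would have \<open>t < 0\<close> and touch
  \<open>y\<close> at some \<open>i\<close>. Row \<open>i\<close> then contradicts the strict
  inequality for \<open>x\<close>, whose direction is reversed by \<open>t\<close>.\<close>

lemma supersolution_nonneg: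
  fixes K :: "nat \<Rightarrow> nat \<Rightarrow> real"
  assumes metzler: "\<And>i j. i < n \<Longrightarrow> j < n \<Longrightarrow> i \<noteq> j \<Longrightarrow> K i j \<ge> 0"
    and pos: "\<And>i. i < n \<Longrightarrow> x i > 0"
    and x: "\<And>i. i < n \<Longrightarrow> (\<Sum>j<n. K i j * x j) < c * x i"
    and y: "\<And>i. i < n \<Longrightarrow> (\<Sum>j<n. K i j * y j) \<le> c * y i"
    and "k < n"
  shows "y k \<ge> 0"
proof (rule ccontr)
  assume neg: "\<not> y k \<ge> 0"
  have "n > 0" using \<open>k < n\<close> by simp
  obtain t i where i: "i < n" and ti: "y i = t * x i" and t: "\<forall>j<n. t * x j \<le> y j"
    using minimal_ratio[of n x y, OF \<open>n > 0\<close> pos] by auto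
  have "t * x k < 0" using t \<open>k < n\<close> neg by fastforce
  then have "t < 0" using pos[OF \<open>k < n\<close>] by (simp add: mult_less_0_iff)
  have "K i j * (t * x j) \<le> K i j * y j" if "j < n" for j
    using metzler[OF i that] t that ti by (cases "j = i") (auto intro: mult_left_mono)
  then have "(\<Sum>j<n. K i j * (t * x j)) \<le> (\<Sum>j<n. K i j * y j)"
    by (intro sum_mono) auto
  also have "\<dots> \<le> t * (c * x i)" using y[OF i] ti by (simp add: algebra_simps)
  also have "\<dots> < t * (\<Sum>j<n. K i j * x j)"
    using x[OF i] \<open>t < 0\<close> by (simp add: mult_less_cancel_left)
  also have "\<dots> = (\<Sum>j<n. K i j * (t * x j))" by (simp add: sum_distrib_left algebra_simps)
  finally show False by simp
qed

section \<open>Continuity of determinants and of solutions of linear systems\<close>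

lemma continuous_det:
  fixes f :: "real \<Rightarrow> nat \<Rightarrow> nat \<Rightarrow> real"
  assumes "\<And>i j. isCont (\<lambda>s. f s i j) c"
  shows "isCont (\<lambda>s. det (mat n n (\<lambda>(i, j). f s i j))) c"
proof -
  have "det (mat n n (\<lambda>(i, j). f s i j)) =
      (\<Sum>p\<in>{p. p permutes {0..<n}}. signof p * (\<Prod>i = 0..<n. f s i (p i)))" for s
    by (subst det_def'[of _ n])
      (auto intro!: sum.cong prod.cong simp: permutes_in_image)
  then show ?thesis using assms by (auto intro!: continuous_intros)
qed

lemma det_zero_imp_kernel:
  fixes f :: "nat \<Rightarrow> nat \<Rightarrow> real"
  assumes "det (mat n n (\<lambda>(i, j). f i j)) = 0"
  obtains v where "\<exists>i<n. v i \<noteq> 0" "\<And>i. i < n \<Longrightarrow> (\<Sum>j<n. f i j * v j) = 0"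
proof -
  let ?A = "mat n n (\<lambda>(i, j). f i j)"
  obtain v where v: "v \<in> carrier_vec n" "v \<noteq> 0\<^sub>v n" "?A *\<^sub>v v = 0\<^sub>v n"
    using assms det_0_iff_vec_prod_zero_field[of ?A n] by auto
  have "\<exists>i<n. v $ i \<noteq> 0" using v(1,2) by (auto simp: vec_eq_iff)
  moreover have "(\<Sum>j<n. f i j * v $ j) = 0" if "i < n" for i
    using arg_cong[OF v(3), of "\<lambda>w. w $ i"] that v(1)
    by (simp add: scalar_prod_def lessThan_atLeast0)
  ultimately show ?thesis using that by blast
qed

text \<open>Cramer's rule expresses the solution through determinants, which are continuous. The
  equation holds on \<open>nhds c\<close>, thus both near \<open>c\<close>, where signs are known,
  and at \<open>c\<close> itself, where the limit is taken.\<close>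

lemma continuous_solution:
  fixes f :: "real \<Rightarrow> nat \<Rightarrow> nat \<Rightarrow> real"
  assumes cont: "\<And>i j c. isCont (\<lambda>s. f s i j) c"
    and "det (mat n n (\<lambda>(i, j). f c i j)) \<noteq> 0"
  obtains y where "\<And>i. i < n \<Longrightarrow> isCont (\<lambda>s. y s i) c"
    and "\<forall>\<^sub>F s in nhds c. \<forall>i<n. (\<Sum>j<n. f s i j * y s j) = 1"
proof -
  define A where "A s = mat n n (\<lambda>(i, j). f s i j)" for s
  \<comment> \<open>This is the inverse of \<open>A s\<close> applied to the all-ones vector: row
    sums of the adjugate over the determinant.\<close>
  define y where "y s i = (\<Sum>j<n. cofactor (A s) j i) / det (A s)" for s i
  have A: "A s \<in> carrier_mat n n" for s by (simp add: A_def)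
  have det: "isCont (\<lambda>s. det (A s)) c"
    unfolding A_def by (rule continuous_det[OF cont])
  have "isCont (\<lambda>s. y s i) c" if "i < n" for i
  proof -
    have "mat_delete (A s) j i = mat (n - 1) (n - 1) (\<lambda>(i', j').
        f s (if i' < j then i' else Suc i') (if j' < i then j' else Suc j'))"
      if "j < n" for s j
      using that \<open>i < n\<close> by (auto simp: mat_delete_def A_def intro!: eq_matI)
    then have "isCont (\<lambda>s. cofactor (A s) j i) c" if "j < n" for j
      unfolding cofactor_def using that
      by (simp, intro continuous_intros continuous_det cont)
    then show ?thesis
      unfolding y_def using det assms(2) by (auto simp: A_def intro!: continuous_intros)
  qed
  moreover have "(\<Sum>j<n. f s i j * y s j) = 1" if "det (A s) \<noteq> 0" "i < n" for s i
  proof -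
    have "(\<Sum>k<n. f s i k * cofactor (A s) j k) = (if i = j then det (A s) else 0)"
      if "j < n" for j
      using arg_cong[OF adj_mat(2)[OF A], of "\<lambda>B. B $$ (i, j)" s] \<open>i < n\<close> that
      by (simp add: adj_mat_def A_def scalar_prod_def lessThan_atLeast0)
    then have *: "(\<Sum>j<n. \<Sum>k<n. f s i k * cofactor (A s) j k) = det (A s)"
      using \<open>i < n\<close> by simp
    have "(\<Sum>k<n. f s i k * y s k) = (\<Sum>k<n. \<Sum>j<n. f s i k * cofactor (A s) j k) / det (A s)"
      by (simp add: y_def sum_distrib_left sum_divide_distrib)
    also have "\<dots> = 1" using * that(1) by (subst sum.swap) simp
    finally show ?thesis .
  qed
  moreover have "\<forall>\<^sub>F s in nhds c. det (A s) \<noteq> 0"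
    using det assms(2) tendsto_at_iff_tendsto_nhds[of "\<lambda>s. det (A s)" c]
    unfolding isCont_def A_def by (intro tendsto_imp_eventually_ne) auto
  ultimately show ?thesis by (intro that[of y]) (auto elim!: eventually_mono)
qed

section \<open>The dominant eigenvalue of a matrix with nonnegative off-diagonal entries\<close>

lemma metzler_eigenvalue:
  fixes K :: "nat \<Rightarrow> nat \<Rightarrow> real"
  assumes "n > 0"
    and metzler: "\<And>i j. i < n \<Longrightarrow> j < n \<Longrightarrow> i \<noteq> j \<Longrightarrow> K i j \<ge> 0"
  shows "\<exists>v \<mu>. (\<exists>i<n. v i \<noteq> 0) \<and> (\<forall>i<n. (\<Sum>j<n. K i j * v j) = \<mu> * v i) \<and>
    (\<forall>c>\<mu>. \<exists>x. (\<forall>i<n. x i > 0) \<and> (\<forall>i<n. (\<Sum>j<n. K i j * x j) < c * x i))"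
proof -
  define P where
    "P c x \<longleftrightarrow> (\<forall>i<n. x i > 0) \<and> (\<forall>i<n. (\<Sum>j<n. K i j * x j) < c * x i)" for c and x :: "nat \<Rightarrow> real"
  define S where "S = {c. \<exists>x. P c x}"
  have up: "c' \<in> S" if "c \<in> S" "c \<le> c'" for c c'
  proof -
    from that obtain x where "P c x" by (auto simp: S_def)
    then have "P c' x" using that(2) unfolding P_def
      by (meson less_le_trans less_imp_le mult_right_mono)
    then show ?thesis by (auto simp: S_def)
  qed
  \<comment> \<open>The diagonal entry is split off because its sign is unrestricted.\<close>
  have split: "(\<Sum>j<n. K i j * x j) = K i i * x i + (\<Sum>j\<in>{..<n} - {i}. K i j * x j)"
    if "i < n" for i x using that by (simp add: sum.remove)
  have off: "(\<Sum>j\<in>{..<n} - {i}. K i j * x j) \<ge> 0" if "i < n" "\<And>j. j < n \<Longrightarrow> x j \<ge> 0" for i x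
    using that metzler by (intro sum_nonneg) auto
  have "S \<noteq> {}"
  proof -
    \<comment> \<open>With \<open>m\<close> the largest row sum, the all-ones vector satisfies the
      strict inequality for \<open>m + 1\<close>.\<close>
    define m where "m = Max ((\<lambda>i. \<Sum>j<n. K i j) ` {..<n})"
    have "(\<Sum>j<n. K i j) \<le> m" if "i < n" for i
      unfolding m_def using that by (intro Max_ge) auto
    then have "P (m + 1) (\<lambda>_. 1)" unfolding P_def by fastforce
    then show ?thesis by (auto simp: S_def)
  qed
  have low: "K 0 0 \<le> c" if "c \<in> S" for c
  proof -
    from that obtain x where x: "P c x" by (auto simp: S_def)
    then have "K 0 0 * x 0 < c * x 0"
      using split[of 0 x] off[of 0 x] \<open>n > 0\<close> unfolding P_def by fastforce
    then show ?thesis using x \<open>n > 0\<close> unfolding P_def by (auto simp: mult_less_cancel_right)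
  qed
  then have bdd: "bdd_below S" by (auto simp: bdd_below_def)
  define \<mu> where "\<mu> = Inf S"
  have above: "c \<in> S" if "c > \<mu>" for c
    using that up cInf_lessD[OF \<open>S \<noteq> {}\<close>, of c] unfolding \<mu>_def by (meson less_imp_le)
  \<comment> \<open>A witness \<open>x\<close> for \<open>\<mu>\<close> satisfies finitely many
    strict inequalities that are continuous in \<open>c\<close>, so it also serves for some
    \<open>c < \<mu>\<close>.\<close>
  have "\<mu> \<notin> S"
  proof
    assume "\<mu> \<in> S"
    then obtain x where x: "P \<mu> x" by (auto simp: S_def)
    have "isCont (\<lambda>c. c * x i) \<mu>" for i by (intro continuous_intros)
    then have "\<forall>\<^sub>F c in at_left \<mu>. (\<Sum>j<n. K i j * x j) < c * x i" if "i < n" for i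
      using x that unfolding P_def isCont_def
      by (intro order_tendstoD(1)[of _ "\<mu> * x i"]) (auto intro: filterlim_mono[OF _ order_refl at_le])
    then have "\<forall>\<^sub>F c in at_left \<mu>. \<forall>i\<in>{..<n}. (\<Sum>j<n. K i j * x j) < c * x i"
      by (intro eventually_ball_finite) auto
    moreover have "\<forall>\<^sub>F c in at_left \<mu>. c < \<mu>"
      by (simp add: eventually_at_filter)
    ultimately have "\<forall>\<^sub>F c in at_left \<mu>. c < \<mu> \<and> c \<in> S"
      by eventually_elim (use x in \<open>auto simp: S_def P_def\<close>)
    then obtain c where "c < \<mu>" "c \<in> S"
      using eventually_happens'[OF trivial_limit_at_left_real] by blast
    then show False using cInf_lower[OF _ bdd] unfolding \<mu>_def by fastforce
  qed
  define f where "f c i j = (if i = j then c else 0) - K i j" for c i j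
  have f: "(\<Sum>j<n. f c i j * x j) = c * x i - (\<Sum>j<n. K i j * x j)" if "i < n" for c i x
  proof -
    have "(\<Sum>j<n. f c i j * x j) = (\<Sum>j<n. (if i = j then c * x j else 0) - K i j * x j)"
      by (intro sum.cong) (auto simp: f_def algebra_simps)
    then show ?thesis using that by (simp add: sum_subtractf)
  qed
  have cont: "isCont (\<lambda>s. f s i j) c" for i j c
    unfolding f_def by (cases "i = j") (auto intro!: continuous_intros)
  have "det (mat n n (\<lambda>(i, j). f \<mu> i j)) = 0"
  proof (rule ccontr)
    assume nz: "\<not> ?thesis"
    obtain y where y: "\<And>i. i < n \<Longrightarrow> isCont (\<lambda>s. y s i) \<mu>"
      and sol: "\<forall>\<^sub>F s in nhds \<mu>. \<forall>i<n. (\<Sum>j<n. f s i j * y s j) = 1"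
      by (rule continuous_solution[OF cont nz]) blast
    have "\<forall>\<^sub>F s in at_right \<mu>. \<forall>i<n. (\<Sum>j<n. f s i j * y s j) = 1"
      using sol by (auto simp: eventually_at_filter elim: eventually_mono)
    moreover have "\<forall>\<^sub>F s in at_right \<mu>. s > \<mu>" by (simp add: eventually_at_filter)
    \<comment> \<open>For \<open>s > \<mu>\<close> a positive strict supersolution exists, so the
      minimum principle applies to \<open>y s\<close>.\<close>
    ultimately have nonneg: "\<forall>\<^sub>F s in at_right \<mu>. \<forall>i<n. y s i \<ge> 0"
    proof eventually_elim
      case (elim s)
      from above[OF elim(2)] obtain x where x: "P s x" by (auto simp: S_def)
      have "(\<Sum>j<n. K i j * y s j) \<le> s * y s i" if "i < n" for i
        using elim(1) f[OF that] that by fastforce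
      then show ?case
        using supersolution_nonneg[of n K x s "y s"] metzler x unfolding P_def by blast
    qed
    have y0: "y \<mu> i \<ge> 0" if "i < n" for i
    proof (rule tendsto_lowerbound[of "\<lambda>s. y s i" _ "at_right \<mu>"])
      show "((\<lambda>s. y s i) \<longlongrightarrow> y \<mu> i) (at_right \<mu>)"
        using y[OF that] unfolding isCont_def by (auto intro: filterlim_mono[OF _ order_refl at_le])
      show "\<forall>\<^sub>F s in at_right \<mu>. 0 \<le> y s i" using nonneg that by (auto elim: eventually_mono)
    qed simp
    have eq: "(\<Sum>j<n. K i j * y \<mu> j) + 1 = \<mu> * y \<mu> i" if "i < n" for i
      using eventually_nhds_x_imp_x[OF sol] f[OF that, of \<mu> "y \<mu>"] that by simp
    \<comment> \<open>If \<open>y \<mu> i\<close> were zero, the left side of \<open>eq\<close>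
      would be at least 1 and the right side 0. Hence \<open>y \<mu>\<close> is positive and puts
      \<open>\<mu>\<close> into \<open>S\<close>.\<close>
    have "y \<mu> i \<noteq> 0" if "i < n" for i
      using eq[OF that] split[OF that, of "y \<mu>"] off[of i "y \<mu>", OF that y0] by auto
    then have "P \<mu> (y \<mu>)" using y0 eq unfolding P_def by (smt (verit))
    then show False using \<open>\<mu> \<notin> S\<close> by (auto simp: S_def)
  qed
  then obtain v where "\<exists>i<n. v i \<noteq> 0" "\<And>i. i < n \<Longrightarrow> (\<Sum>j<n. f \<mu> i j * v j) = 0"
    by (rule det_zero_imp_kernel) blast
  then show ?thesis using above f unfolding S_def P_def by (intro exI[of _ v] exI[of _ \<mu>]) auto
qed

section \<open>Eigenvectors in coordinates, and rooted matrices\<close>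

lemma eigenvector_iff_sums:
  assumes "A \<in> carrier_mat n n"
  shows "eigenvector A v k \<longleftrightarrow> v \<in> carrier_vec n \<and> (\<exists>i<n. v $ i \<noteq> 0) \<and>
    (\<forall>i<n. (\<Sum>j<n. A $$ (i, j) * v $ j) = k * v $ i)"
proof (cases "v \<in> carrier_vec n")
  case True
  then have dim: "dim_vec v = n" "dim_row A = n" "dim_col A = n" using assms by auto
  have "(A *\<^sub>v v) $ i = (\<Sum>j<n. A $$ (i, j) * v $ j)" if "i < n" for i
    using that dim by (simp add: scalar_prod_def lessThan_atLeast0)
  then have "A *\<^sub>v v = k \<cdot>\<^sub>v v \<longleftrightarrow> (\<forall>i<n. (\<Sum>j<n. A $$ (i, j) * v $ j) = k * v $ i)"
    using dim by (auto simp: vec_eq_iff simp del: index_mult_mat_vec)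
  moreover have "v \<noteq> 0\<^sub>v n \<longleftrightarrow> (\<exists>i<n. v $ i \<noteq> 0)" using dim by (auto simp: vec_eq_iff)
  ultimately show ?thesis using True dim by (simp add: eigenvector_def)
next
  case False
  then show ?thesis using assms by (simp add: eigenvector_def)
qed

lemma eigenvalue_if_sums:
  assumes "A \<in> carrier_mat n n" "\<exists>i<n. v i \<noteq> 0"
    and "\<And>i. i < n \<Longrightarrow> (\<Sum>j<n. A $$ (i, j) * v j) = k * v i"
  shows "eigenvalue A k"
  unfolding eigenvalue_def eigenvector_iff_sums[OF assms(1)]
  using assms by (intro exI[of _ "vec n v"]) auto

lemma rooted_mat_eigenvalue:
  assumes "l > 0" and M: "M \<in> carrier_mat l l" and "rooted_mat M"
  obtains \<mu> where "eigenvalue M \<mu>"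
    "\<And>c. c > \<mu> \<Longrightarrow> \<exists>v. (\<forall>a<l. v a > 0) \<and> (\<forall>a<l. v a \<ge> v (l - 1)) \<and>
      (\<forall>a<l. (\<Sum>b<l. M $$ (a, b) * v b) \<le> c * v a)"
proof -
  obtain m where l: "l = Suc m" using \<open>l > 0\<close> gr0_implies_Suc by blast
  have dim: "dim_row M = Suc m" "dim_col M = Suc m" using M l by auto
  \<comment> \<open>\<open>V x\<close> is the vector with coordinates \<open>x\<close> in the basis
    of the first \<open>m\<close> unit vectors and the all-ones vector. \<open>G\<close> is
    \<open>M\<close> times this change of basis, and subtracting the last row, the inverse change,
    turns \<open>G\<close> into \<open>K\<close>.\<close>
  define G where "G i j = (if j < m then M $$ (i, j) else \<Sum>c<l. M $$ (i, c))" for i j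
  define K where "K i j = G i j - (if i < m then G m j else 0)" for i j
  define V where "V x i = (if i < m then x i + x m else x m)" for x :: "nat \<Rightarrow> real" and i
  have metzler: "K i j \<ge> 0" if ij: "i < l" "j < l" "i \<noteq> j" for i j
  proof -
    from \<open>rooted_mat M\<close> obtain d where
      d: "\<And>j. j < m \<Longrightarrow> rooted_vec (col (M + d \<cdot>\<^sub>m 1\<^sub>m (Suc m)) j)"
        "rooted_vec (row_sum_vec (M + d \<cdot>\<^sub>m 1\<^sub>m (Suc m)))"
      unfolding rooted_mat_def Let_def dim by auto
    \<comment> \<open>The shift by \<open>d\<close> adds the same constant to every row sum and thus
      cancels in their differences. In the first \<open>m\<close> columns it alters only diagonal
      entries, so it does not touch the off-diagonal entries of \<open>K\<close>.\<close>
    have rs: "row_sum_vec (M + d \<cdot>\<^sub>m 1\<^sub>m (Suc m)) $ i = (\<Sum>c<Suc m. M $$ (i, c)) + d"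
      if "i < Suc m" for i
    proof -
      have "row_sum_vec (M + d \<cdot>\<^sub>m 1\<^sub>m (Suc m)) $ i =
          (\<Sum>c<Suc m. M $$ (i, c) + d * (if i = c then 1 else 0))"
        unfolding row_sum_vec_def using that by (auto simp: dim simp del: sum.lessThan_Suc intro!: sum.cong)
      also have "\<dots> = (\<Sum>c<Suc m. M $$ (i, c)) + d"
        unfolding sum.distrib sum_distrib_left[symmetric] using that by (simp del: sum.lessThan_Suc)
      finally show ?thesis .
    qed
    show ?thesis
    proof (cases "j < m")
      case True
      have "(i < m \<longrightarrow> M $$ (m, j) \<le> M $$ (i, j)) \<and> M $$ (m, j) \<ge> 0"
        using d(1)[OF True] True ij l unfolding rooted_vec_def by (auto simp: dim)
      then show ?thesis using True ij l by (auto simp: K_def G_def less_Suc_eq)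
    next
      case False
      then have "j = m" "i < m" using ij l by auto
      moreover have "row_sum_vec (M + d \<cdot>\<^sub>m 1\<^sub>m (Suc m)) $ m \<le> row_sum_vec (M + d \<cdot>\<^sub>m 1\<^sub>m (Suc m)) $ i"
        using d(2) \<open>i < m\<close> unfolding rooted_vec_def by (simp add: row_sum_vec_def dim)
      ultimately show ?thesis using rs[of m] rs[of i] by (simp add: K_def G_def l)
    qed
  qed
  have MV: "(\<Sum>b<l. M $$ (a, b) * V x b) = (\<Sum>j<l. G a j * x j)" for a x
    by (simp add: l V_def G_def sum.distrib algebra_simps sum_distrib_left)
  have K: "(\<Sum>j<l. K i j * x j) =
      (\<Sum>b<l. M $$ (i, b) * V x b) - (if i < m then \<Sum>b<l. M $$ (m, b) * V x b else 0)" for i x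
    unfolding MV K_def by (simp add: left_diff_distrib sum_subtractf)
  obtain \<mu> x where x: "\<exists>i<l. x i \<noteq> 0" and eig: "\<forall>i<l. (\<Sum>j<l. K i j * x j) = \<mu> * x i"
    and above: "\<forall>c>\<mu>. \<exists>x. (\<forall>i<l. x i > 0) \<and> (\<forall>i<l. (\<Sum>j<l. K i j * x j) < c * x i)"
    by atomize_elim (rule metzler_eigenvalue[OF \<open>l > 0\<close>], simp add: metzler)
  show ?thesis
  proof (rule that)
    show "eigenvalue M \<mu>"
    proof (rule eigenvalue_if_sums[OF M])
      show "\<exists>i<l. V x i \<noteq> 0"
      proof (cases "x m = 0")
        case True
        then show ?thesis using x by (auto simp: V_def l less_Suc_eq)
      next
        case False
        then show ?thesis by (intro exI[of _ m]) (simp add: V_def l)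
      qed
      have "(\<Sum>j<l. M $$ (m, j) * V x j) = \<mu> * x m" using K[where x=x and i=m] eig l by simp
      then show "(\<Sum>j<l. M $$ (i, j) * V x j) = \<mu> * V x i" if "i < l" for i
        using K[where x=x and i=i] eig that l
        by (cases "i < m") (auto simp: V_def algebra_simps less_Suc_eq)
    qed
    fix c assume "c > \<mu>"
    with above obtain x where x: "\<And>i. i < l \<Longrightarrow> x i > 0"
      "\<And>i. i < l \<Longrightarrow> (\<Sum>j<l. K i j * x j) < c * x i" by blast
    have m: "(\<Sum>j<l. M $$ (m, j) * V x j) < c * x m" using K[where x=x and i=m] x(2)[of m] l by simp
    \<comment> \<open>For \<open>i < m\<close> this is the sum of the inequalities for the
      coordinates \<open>i\<close> and \<open>m\<close>.\<close>
    have "(\<Sum>j<l. M $$ (i, j) * V x j) \<le> c * V x i" if "i < l" for i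
      using K[where x=x and i=i] x(2)[OF that] that l m
      by (cases "i < m") (auto simp: V_def algebra_simps less_Suc_eq)
    moreover have "V x i > 0" "V x i \<ge> V x (l - 1)" if "i < l" for i
      using x(1)[OF that] x(1)[of m] l by (auto simp: V_def)
    ultimately show "\<exists>v. (\<forall>a<l. v a > 0) \<and> (\<forall>a<l. v a \<ge> v (l - 1)) \<and>
      (\<forall>a<l. (\<Sum>b<l. M $$ (a, b) * v b) \<le> c * v a)" by blast
  qed
qed

section \<open>Spectral radius of nonnegative matrices\<close>

text \<open>Let \<open>z\<close> be the entrywise moduli of a complex eigenvector whose eigenvalue
  has maximal modulus, and use the triangle inequality.\<close>

lemma spectral_radius_subinvariant:
  assumes "n > 0" and C: "C \<in> carrier_mat n n" and nonneg: "\<And>i j. i < n \<Longrightarrow> j < n \<Longrightarrow> C $$ (i, j) \<ge> 0"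
  obtains z where "\<And>i. z i \<ge> 0" "\<exists>i<n. z i > 0"
    "\<And>i. i < n \<Longrightarrow> real_spectral_radius C * z i \<le> (\<Sum>j<n. C $$ (i, j) * z j)"
proof -
  let ?C = "map_mat complex_of_real C"
  have CC: "?C \<in> carrier_mat n n" using C by simp
  obtain k where k: "norm k = real_spectral_radius C" "eigenvalue ?C k"
    using spectral_radius_mem_max(1)[OF CC \<open>n > 0\<close>]
    unfolding real_spectral_radius_def spectrum_def by auto
  then obtain v where v: "\<exists>i<n. v $ i \<noteq> 0" "\<And>i. i < n \<Longrightarrow> (\<Sum>j<n. ?C $$ (i, j) * v $ j) = k * v $ i"
    unfolding eigenvalue_def eigenvector_iff_sums[OF CC] by auto
  have "real_spectral_radius C * norm (v $ i) \<le> (\<Sum>j<n. C $$ (i, j) * norm (v $ j))" if "i < n" for i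
  proof -
    have "real_spectral_radius C * norm (v $ i) = norm (\<Sum>j<n. ?C $$ (i, j) * v $ j)"
      using v(2)[OF that] k(1) by (simp add: norm_mult)
    also have "\<dots> \<le> (\<Sum>j<n. norm (?C $$ (i, j) * v $ j))" by (rule norm_sum)
    also have "\<dots> = (\<Sum>j<n. C $$ (i, j) * norm (v $ j))"
      using that C nonneg by (intro sum.cong) (auto simp: norm_mult)
    finally show ?thesis .
  qed
  then show ?thesis using that[of "\<lambda>i. norm (v $ i)"] v(1) by auto
qed

lemma real_eigenvalue_le_spectral_radius:
  assumes "n > 0" and C: "C \<in> carrier_mat n n" and "eigenvalue C r"
  shows "r \<le> real_spectral_radius C"
proof -
  let ?C = "map_mat complex_of_real C"
  have CC: "?C \<in> carrier_mat n n" using C by simp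
  obtain v where v: "\<exists>i<n. v $ i \<noteq> 0" "\<And>i. i < n \<Longrightarrow> (\<Sum>j<n. C $$ (i, j) * v $ j) = r * v $ i"
    using assms(3) unfolding eigenvalue_def eigenvector_iff_sums[OF C] by auto
  have "(\<Sum>j<n. ?C $$ (i, j) * complex_of_real (v $ j)) = complex_of_real r * complex_of_real (v $ i)"
    if "i < n" for i
    using arg_cong[OF v(2)[OF that], of complex_of_real] that C by simp
  then have "eigenvalue ?C (complex_of_real r)"
    using v(1) by (intro eigenvalue_if_sums[OF CC]) auto
  then have "norm (complex_of_real r) \<le> real_spectral_radius C"
    unfolding real_spectral_radius_def
    by (intro spectral_radius_mem_max(2)[OF CC \<open>n > 0\<close>] imageI) (simp add: spectrum_def)
  then show ?thesis by simp
qed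

text \<open>At an index where the least multiple of \<open>w\<close> above a subinvariant
  \<open>z\<close> touches \<open>z\<close>, the inequalities for \<open>z\<close> and
  \<open>w\<close> chain together, and division by the positive entry \<open>z i\<close> gives the
  bound.\<close>

lemma spectral_radius_le_if_supersolution:
  assumes "n > 0" and C: "C \<in> carrier_mat n n" and nonneg: "\<And>i j. i < n \<Longrightarrow> j < n \<Longrightarrow> C $$ (i, j) \<ge> 0"
    and pos: "\<And>i. i < n \<Longrightarrow> w i > 0"
    and w: "\<And>i. i < n \<Longrightarrow> (\<Sum>j<n. C $$ (i, j) * w j) \<le> c * w i"
  shows "real_spectral_radius C \<le> c"
proof -
  obtain z where z: "\<And>i. z i \<ge> 0" "\<exists>i<n. z i > 0"
    "\<And>i. i < n \<Longrightarrow> real_spectral_radius C * z i \<le> (\<Sum>j<n. C $$ (i, j) * z j)"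
    by (rule spectral_radius_subinvariant[OF \<open>n > 0\<close> C nonneg]) blast+
  \<comment> \<open>The dominating multiple of \<open>w\<close> is \<open>- s * w\<close>;
    \<open>s\<close> is negative because \<open>z\<close> has a positive entry.\<close>
  obtain s i where i: "i < n" "- z i = s * w i" "\<forall>j<n. s * w j \<le> - z j"
    using minimal_ratio[of n w "\<lambda>i. - z i", OF \<open>n > 0\<close> pos] by auto
  obtain k where "k < n" "z k > 0" using z(2) by blast
  then have "s * w k < 0" using i(3) by fastforce
  then have "s < 0" using pos[OF \<open>k < n\<close>] by (simp add: mult_less_0_iff)
  then have "z i > 0" using i(2) mult_neg_pos[OF _ pos[OF i(1)], of s] by simp
  have "real_spectral_radius C * z i \<le> (\<Sum>j<n. C $$ (i, j) * z j)" using z(3)[OF i(1)] .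
  also have "\<dots> \<le> (\<Sum>j<n. C $$ (i, j) * (- s * w j))"
    using i(1,3) nonneg by (intro sum_mono mult_left_mono) (auto simp: le_minus_iff)
  also have "\<dots> = - s * (\<Sum>j<n. C $$ (i, j) * w j)" by (simp add: sum_distrib_left algebra_simps)
  also have "\<dots> \<le> - s * (c * w i)" using w[OF i(1)] \<open>s < 0\<close> by (intro mult_left_mono) auto
  also have "\<dots> = c * z i" using arg_cong[OF i(2), of "\<lambda>y. c * y"] by (simp add: algebra_simps)
  finally show ?thesis using \<open>z i > 0\<close> by simp
qed

section \<open>Irreducibility and positivity\<close>

text \<open>Listing the complement of \<open>Z\<close> first and \<open>Z\<close> last moves the
  zero block to the lower left corner.\<close>

lemma reducible_if_zero_block:
  assumes "C \<in> carrier_mat n n" and "Z \<subseteq> {..<n}" "Z \<noteq> {}" "Z \<noteq> {..<n}"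
    and zero: "\<And>i j. i \<in> Z \<Longrightarrow> j < n \<Longrightarrow> j \<notin> Z \<Longrightarrow> C $$ (i, j) = 0"
  shows "reducible_mat C"
proof -
  let ?Y = "{..<n} - Z"
  define k where "k = card ?Y"
  have fin: "finite Z" using assms(2) finite_subset by blast
  have n: "n = k + card Z"
    using assms(2) fin card_Diff_subset[OF fin assms(2)] card_mono[OF _ assms(2)] by (simp add: k_def)
  have "card Z > 0" using fin assms(3) by auto
  have "k > 0" unfolding k_def using assms(2,4) by (auto simp: card_gt_0_iff)
  obtain g where g: "bij_betw g {..<k} ?Y"
    using finite_same_card_bij[of "{..<k}" ?Y] by (auto simp: k_def)
  obtain h where h: "bij_betw h {k..<n} Z"
    using finite_same_card_bij[of "{k..<n}" Z] fin n by auto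
  define p where "p i = (if i < k then g i else if i < n then h i else i)" for i
  have p: "bij_betw p {..<k} ?Y" using g by (rule bij_betw_cong[THEN iffD1, rotated]) (auto simp: p_def)
  have q: "bij_betw p {k..<n} Z"
    using h by (rule bij_betw_cong[THEN iffD1, rotated]) (auto simp: p_def)
  have img: "p ` {..<k} = ?Y" "p ` {k..<n} = Z" using p q by (simp_all add: bij_betw_def)
  have "bij_betw p ({..<k} \<union> {k..<n}) (?Y \<union> Z)" by (rule bij_betw_combine[OF p q]) auto
  moreover have "{..<k} \<union> {k..<n} = {..<n}" "?Y \<union> Z = {..<n}" using n assms(2) by auto
  ultimately have "p permutes {..<n}"
    using n by (intro bij_imp_permutes) (auto simp: p_def)
  moreover have "C $$ (p i, p j) = 0" if "i \<in> {k..<n}" "j < k" for i j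
    using zero[of "p i" "p j"] img that by blast
  ultimately show ?thesis
    unfolding reducible_mat_def using \<open>k > 0\<close> \<open>card Z > 0\<close> n assms(1)
    by (intro exI[of _ p] exI[of _ k]) auto
qed

text \<open>In a row \<open>i\<close> with \<open>x i = 0\<close>, a sum of nonnegative terms is at
  most 0, so \<open>C\<close> vanishes from the zero set of \<open>x\<close> to its complement.
  Irreducibility leaves no proper nonempty zero set.\<close>

lemma irreducible_supersolution_zero:
  assumes C: "C \<in> carrier_mat n n" and nonneg: "\<And>i j. i < n \<Longrightarrow> j < n \<Longrightarrow> C $$ (i, j) \<ge> 0"
    and "irreducible_mat C"
    and x: "\<And>i. i < n \<Longrightarrow> x i \<ge> 0"
    and sup: "\<And>i. i < n \<Longrightarrow> (\<Sum>j<n. C $$ (i, j) * x j) \<le> r * x i"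
    and zero: "\<exists>i<n. x i = 0" and "k < n"
  shows "x k = 0"
proof (rule ccontr)
  assume "x k \<noteq> 0"
  define Z where "Z = {i. i < n \<and> x i = 0}"
  have "reducible_mat C"
  proof (rule reducible_if_zero_block[OF C])
    show "Z \<subseteq> {..<n}" "Z \<noteq> {}" using zero by (auto simp: Z_def)
    show "Z \<noteq> {..<n}" using \<open>k < n\<close> \<open>x k \<noteq> 0\<close> by (auto simp: Z_def)
    fix i j assume i: "i \<in> Z" and j: "j < n" "j \<notin> Z"
    have "(\<Sum>j<n. C $$ (i, j) * x j) \<le> 0" using sup[of i] i by (simp add: Z_def)
    moreover have "C $$ (i, j) * x j \<le> (\<Sum>j<n. C $$ (i, j) * x j)"
      using i j nonneg x by (intro member_le_sum) (auto simp: Z_def)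
    moreover have "C $$ (i, j) \<ge> 0" "x j > 0" using i j nonneg x[of j] by (auto simp: Z_def less_le)
    ultimately show "C $$ (i, j) = 0" by (smt (verit) mult_pos_pos)
  qed
  then show False using assms(3) by (simp add: irreducible_mat_def)
qed

lemma irreducible_supersolution_eigenvector:
  assumes "n > 0" and C: "C \<in> carrier_mat n n" and nonneg: "\<And>i j. i < n \<Longrightarrow> j < n \<Longrightarrow> C $$ (i, j) \<ge> 0"
    and irr: "irreducible_mat C"
    and w0: "\<And>i. i < n \<Longrightarrow> w i \<ge> 0" and ne: "\<exists>i<n. w i \<noteq> 0"
    and w: "\<And>i. i < n \<Longrightarrow> (\<Sum>j<n. C $$ (i, j) * w j) \<le> real_spectral_radius C * w i"
    and "k < n"
  shows "(\<Sum>j<n. C $$ (k, j) * w j) = real_spectral_radius C * w k"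
proof -
  let ?r = "real_spectral_radius C"
  \<comment> \<open>One zero entry would force \<open>w\<close> to vanish identically.\<close>
  have "w i \<noteq> 0" if "i < n" for i
    using irreducible_supersolution_zero[OF C nonneg irr w0 w] ne that by blast
  then have pos: "w i > 0" if "i < n" for i using w0[OF that] that by (simp add: less_le)
  obtain z where z: "\<And>i. z i \<ge> 0" "\<exists>i<n. z i > 0"
    "\<And>i. i < n \<Longrightarrow> ?r * z i \<le> (\<Sum>j<n. C $$ (i, j) * z j)"
    by (rule spectral_radius_subinvariant[OF \<open>n > 0\<close> C nonneg]) blast+
  obtain s i where i: "i < n" "- z i = s * w i" "\<forall>j<n. s * w j \<le> - z j"
    using minimal_ratio[of n w "\<lambda>i. - z i", OF \<open>n > 0\<close> pos] by auto
  obtain k' where "k' < n" "z k' > 0" using z(2) by blast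
  then have "s * w k' < 0" using i(3) by fastforce
  then have "s < 0" using pos[OF \<open>k' < n\<close>] by (simp add: mult_less_0_iff)
  \<comment> \<open>The gap between the dominating multiple of \<open>w\<close> and
    \<open>z\<close>. It is nonnegative, vanishes at \<open>i\<close> and satisfies
    \<open>C x \<le> ?r x\<close>, hence is zero. So \<open>z\<close> is a multiple of
    \<open>w\<close>, and subinvariance of \<open>z\<close> becomes the reverse inequality for
    \<open>w\<close>.\<close>
  define x where "x j = - s * w j - z j" for j
  have Cx: "(\<Sum>j<n. C $$ (a, j) * x j) = - s * (\<Sum>j<n. C $$ (a, j) * w j) - (\<Sum>j<n. C $$ (a, j) * z j)" for a
    by (simp add: x_def sum_distrib_left sum_subtractf sum_negf algebra_simps)
  have "x j = 0" if "j < n" for j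
  proof (rule irreducible_supersolution_zero[OF C nonneg irr _ _ _ that])
    show "x j \<ge> 0" if "j < n" for j using i(3) that by (simp add: x_def le_minus_iff)
    show "\<exists>i<n. x i = 0" using i(1,2) by (auto simp: x_def)
    show "(\<Sum>j<n. C $$ (a, j) * x j) \<le> ?r * x a" if "a < n" for a
    proof -
      have "- s * (\<Sum>j<n. C $$ (a, j) * w j) \<le> - s * (?r * w a)"
        using w[OF that] \<open>s < 0\<close> by (intro mult_left_mono) auto
      then show ?thesis unfolding Cx using z(3)[OF that] by (simp add: x_def algebra_simps)
    qed
  qed
  then have "z k = - s * w k" "(\<Sum>j<n. C $$ (k, j) * x j) = 0" using \<open>k < n\<close> by (auto simp: x_def)
  then have "- s * (?r * w k) \<le> - s * (\<Sum>j<n. C $$ (k, j) * w j)"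
    using z(3)[OF \<open>k < n\<close>] Cx[of k] by (simp add: algebra_simps)
  then have "?r * w k \<le> (\<Sum>j<n. C $$ (k, j) * w j)"
    using \<open>s < 0\<close> by (simp add: mult_le_cancel_left)
  then show ?thesis using w[OF \<open>k < n\<close>] by simp
qed

section \<open>Partitions and summation by parts\<close>

text \<open>Composition with this map lifts a vector on the blocks to a blockwise constant vector on
  the indices. The value is unspecified outside the blocks.\<close>

definition block_index :: "nat \<Rightarrow> (nat \<Rightarrow> nat set) \<Rightarrow> nat \<Rightarrow> nat" where
  "block_index l \<pi> i = (THE a. a < l \<and> i \<in> \<pi> a)"

lemma block_index_eq:
  assumes "indexed_partition n l \<pi>" "a < l" "i \<in> \<pi> a"
  shows "block_index l \<pi> i = a"
  unfolding block_index_def using assms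
  by (intro the_equality) (auto simp: indexed_partition_def disjoint_family_on_def)

lemma block_index_less:
  assumes "indexed_partition n l \<pi>" "i < n"
  shows "block_index l \<pi> i < l" "i \<in> \<pi> (block_index l \<pi> i)"
proof -
  obtain a where "a < l" "i \<in> \<pi> a" using assms unfolding indexed_partition_def by blast
  then show "block_index l \<pi> i < l" "i \<in> \<pi> (block_index l \<pi> i)"
    using block_index_eq[OF assms(1)] by auto
qed

lemma sum_over_blocks:
  fixes g x :: "nat \<Rightarrow> real"
  assumes part: "indexed_partition n l \<pi>"
  shows "(\<Sum>j<n. g j * x (block_index l \<pi> j)) = (\<Sum>b<l. (\<Sum>j\<in>\<pi> b. g j) * x b)"
proof -
  have U: "{..<n} = (\<Union>b\<in>{..<l}. \<pi> b)" using part by (simp add: indexed_partition_def)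
  have "finite (\<pi> b)" if "b < l" for b
    using that U by (metis UN_upper finite_lessThan finite_subset lessThan_iff)
  then have "(\<Sum>j<n. g j * x (block_index l \<pi> j)) = (\<Sum>b<l. \<Sum>j\<in>\<pi> b. g j * x (block_index l \<pi> j))"
    unfolding U using part
    by (intro sum.UNION_disjoint) (auto simp: indexed_partition_def disjoint_family_on_def)
  also have "\<dots> = (\<Sum>b<l. (\<Sum>j\<in>\<pi> b. g j) * x b)"
    by (intro sum.cong) (auto simp: sum_distrib_right block_index_eq[OF part])
  finally show ?thesis .
qed

text \<open>Decomposing \<open>x\<close> into multiples \<open>x b - x (l - 1)\<close> of unit
  vectors and \<open>x (l - 1)\<close> times the all-ones vector leaves only the first
  \<open>l - 1\<close> block sums and the full row sum, exactly the quantities bounded in the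
  theorem. For rooted \<open>x\<close> these multiples are nonnegative.\<close>

lemma lifted_row_defect:
  fixes g x p :: "nat \<Rightarrow> real"
  assumes "l > 0" and part: "indexed_partition n l \<pi>"
  shows "(\<Sum>b<l. p b * x b) - (\<Sum>j<n. g j * x (block_index l \<pi> j)) =
    (\<Sum>b<l - 1. (p b - (\<Sum>j\<in>\<pi> b. g j)) * (x b - x (l - 1))) +
    ((\<Sum>b<l. p b) - (\<Sum>j<n. g j)) * x (l - 1)"
proof -
  obtain m where l: "l = Suc m" using \<open>l > 0\<close> gr0_implies_Suc by blast
  have "(\<Sum>j<n. g j) = (\<Sum>b<l. \<Sum>j\<in>\<pi> b. g j)"
    using sum_over_blocks[OF part, of g "\<lambda>_. 1"] by simp
  then show ?thesis
    unfolding sum_over_blocks[OF part] unfolding l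
    by (simp add: algebra_simps sum.distrib sum_subtractf sum_distrib_left sum_distrib_right)
qed

theorem theorem5p1:
  fixes l n :: nat and M C :: "real mat" and \<pi> :: "nat \<Rightarrow> nat set"
  assumes "l > 0" and "n > 0"
    and "M \<in> carrier_mat l l" and "rooted_mat M"
    and "C \<in> carrier_mat n n" and "\<forall>i<n. \<forall>j<n. C $$ (i, j) \<ge> 0"
    and "indexed_partition n l \<pi>"
    and "\<forall>a<l. \<forall>b<l - 1. Max ((\<lambda>i. \<Sum>j\<in>\<pi> b. C $$ (i, j)) ` \<pi> a) \<le> M $$ (a, b)"
    and "\<forall>a<l. Max ((\<lambda>i. \<Sum>j<n. C $$ (i, j)) ` \<pi> a) \<le> (\<Sum>c<l. M $$ (a, c))"
  shows "ereal (real_spectral_radius C) \<le> largest_real_eigenvalue M \<and>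
    (\<forall>u r. ereal r = largest_real_eigenvalue M \<longrightarrow> eigenvector M u r \<longrightarrow> rooted_vec u \<longrightarrow>
       irreducible_mat C \<longrightarrow>
       (ereal (real_spectral_radius C) = largest_real_eigenvalue M \<longleftrightarrow>
          (u $ (l - 1) \<noteq> 0 \<longrightarrow>
             (\<forall>a<l. \<forall>i\<in>\<pi> a. (\<Sum>j<n. C $$ (i, j)) = (\<Sum>c<l. M $$ (a, c)))) \<and>
          (\<forall>a<l. \<forall>b<l - 1. \<forall>i\<in>\<pi> a. u $ b > u $ (l - 1) \<longrightarrow>
             (\<Sum>j\<in>\<pi> b. C $$ (i, j)) = M $$ (a, b))))"
proof -
  let ?\<rho> = "real_spectral_radius C"
  let ?f = "block_index l \<pi>"
  note M = assms(3) and C = assms(5) and part = assms(7)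
  have nonneg: "C $$ (i, j) \<ge> 0" if "i < n" "j < n" for i j using assms(6) that by blast
  have block_less: "i < n" if "a < l" "i \<in> \<pi> a" for a i
    using part that unfolding indexed_partition_def by blast
  have fin: "finite (\<pi> a)" if "a < l" for a
    using block_less[OF that] by (auto intro: finite_subset[of _ "{..<n}"])
  have blk: "(\<Sum>j\<in>\<pi> b. C $$ (i, j)) \<le> M $$ (a, b)" if "a < l" "b < l - 1" "i \<in> \<pi> a" for a b i
    using assms(8) that fin by (meson Max_ge finite_imageI imageI order_trans)
  have row: "(\<Sum>j<n. C $$ (i, j)) \<le> (\<Sum>c<l. M $$ (a, c))" if "a < l" "i \<in> \<pi> a" for a i
    using assms(9) that fin by (meson Max_ge finite_imageI imageI order_trans)
  note defect = lifted_row_defect[OF \<open>l > 0\<close> part]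
  have lift: "(\<Sum>j<n. C $$ (i, j) * x (?f j)) \<le> (\<Sum>b<l. M $$ (a, b) * x b)"
    if "a < l" "i \<in> \<pi> a" "\<And>b. b < l - 1 \<Longrightarrow> x b \<ge> x (l - 1)" "x (l - 1) \<ge> 0" for x a i
  proof -
    have "(\<Sum>b<l - 1. (M $$ (a, b) - (\<Sum>j\<in>\<pi> b. C $$ (i, j))) * (x b - x (l - 1))) \<ge> 0"
      using blk that by (intro sum_nonneg) auto
    moreover have "((\<Sum>c<l. M $$ (a, c)) - (\<Sum>j<n. C $$ (i, j))) * x (l - 1) \<ge> 0"
      using row that by simp
    ultimately show ?thesis using defect[of "\<lambda>b. M $$ (a, b)" x "\<lambda>j. C $$ (i, j)"] by linarith
  qed
  obtain \<mu> where \<mu>: "eigenvalue M \<mu>" and above: "\<And>c. c > \<mu> \<Longrightarrow>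
      \<exists>v. (\<forall>a<l. v a > 0) \<and> (\<forall>a<l. v a \<ge> v (l - 1)) \<and>
      (\<forall>a<l. (\<Sum>b<l. M $$ (a, b) * v b) \<le> c * v a)"
    by (rule rooted_mat_eigenvalue[OF \<open>l > 0\<close> M assms(4)]) blast
  have "?\<rho> \<le> c" if "c > \<mu>" for c
  proof -
    from above[OF that] obtain v where v: "\<And>a. a < l \<Longrightarrow> v a > 0" "\<And>a. a < l \<Longrightarrow> v a \<ge> v (l - 1)"
      "\<And>a. a < l \<Longrightarrow> (\<Sum>b<l. M $$ (a, b) * v b) \<le> c * v a" by blast
    show ?thesis
    proof (rule spectral_radius_le_if_supersolution[OF \<open>n > 0\<close> C nonneg, of "\<lambda>i. v (?f i)"])
      fix i assume "i < n"
      note i = block_index_less[OF part this]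
      show "v (?f i) > 0" using v(1) i by blast
      have "(\<Sum>j<n. C $$ (i, j) * v (?f j)) \<le> (\<Sum>b<l. M $$ (?f i, b) * v b)"
        using i v(2) v(1)[of "l - 1"] \<open>l > 0\<close> by (intro lift) auto
      then show "(\<Sum>j<n. C $$ (i, j) * v (?f j)) \<le> c * v (?f i)" using v(3)[OF i(1)] by linarith
    qed
  qed
  \<comment> \<open>Positive rooted vectors are available only for \<open>c > \<mu>\<close>, so the
    bound at \<open>\<mu>\<close> is reached by density.\<close>
  then have "?\<rho> \<le> \<mu>" by (rule dense_ge)
  \<comment> \<open>Since \<open>\<mu>\<close> is an eigenvalue, the spectrum is nonempty, which
    excludes the value \<infinity>.\<close>
  moreover have "largest_real_eigenvalue M = ereal (Max (spectrum M))" "\<mu> \<le> Max (spectrum M)"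
    using \<mu> card_finite_spectrum(1)[OF M] by (auto simp: largest_real_eigenvalue_def spectrum_def)
  ultimately have le: "ereal ?\<rho> \<le> largest_real_eigenvalue M" by simp
  moreover have "ereal ?\<rho> = largest_real_eigenvalue M \<longleftrightarrow>
          (u $ (l - 1) \<noteq> 0 \<longrightarrow>
             (\<forall>a<l. \<forall>i\<in>\<pi> a. (\<Sum>j<n. C $$ (i, j)) = (\<Sum>c<l. M $$ (a, c)))) \<and>
          (\<forall>a<l. \<forall>b<l - 1. \<forall>i\<in>\<pi> a. u $ b > u $ (l - 1) \<longrightarrow>
             (\<Sum>j\<in>\<pi> b. C $$ (i, j)) = M $$ (a, b))" (is "_ \<longleftrightarrow> ?ab")
    if r: "ereal r = largest_real_eigenvalue M" and u: "eigenvector M u r" "rooted_vec u"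
      and irr: "irreducible_mat C" for u r
  proof -
    let ?w = "\<lambda>i. u $ ?f i"
    have "dim_vec u = l" and une: "\<exists>a<l. u $ a \<noteq> 0"
      and Mu: "\<And>a. a < l \<Longrightarrow> (\<Sum>b<l. M $$ (a, b) * u $ b) = r * u $ a"
      using u(1) unfolding eigenvector_iff_sums[OF M] by auto
    then have root: "\<And>b. b < l - 1 \<Longrightarrow> u $ b \<ge> u $ (l - 1)" "u $ (l - 1) \<ge> 0"
      using u(2) by (auto simp: rooted_vec_def)
    then have u0: "u $ a \<ge> 0" if "a < l" for a
      using that by (cases "a = l - 1") (auto intro: order_trans[OF root(2)])
    have Cw: "(\<Sum>j<n. C $$ (i, j) * ?w j) \<le> r * u $ a" if "a < l" "i \<in> \<pi> a" for a i
      using lift[of a i "\<lambda>b. u $ b"] that root Mu by simp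
    \<comment> \<open>Blocks are nonempty, so every entry of \<open>u\<close> occurs in the
      lift.\<close>
    have wne: "\<exists>i<n. ?w i \<noteq> 0"
    proof -
      obtain a where a: "a < l" "u $ a \<noteq> 0" using une by blast
      then obtain i where "i \<in> \<pi> a" using part unfolding indexed_partition_def by blast
      then show ?thesis using a block_less block_index_eq[OF part] by (metis (no_types))
    qed
    \<comment> \<open>Equality in a row means that its defect, a sum of nonnegative products,
      vanishes term by term. A product is zero exactly when its weight
      \<open>u $ b - u $ (l - 1)\<close> or \<open>u $ (l - 1)\<close> is zero or the corresponding
      sums agree, which gives (b) and (a).\<close>
    have "(\<Sum>j<n. C $$ (i, j) * ?w j) = r * u $ a \<longleftrightarrow>
        (\<forall>b<l - 1. u $ b > u $ (l - 1) \<longrightarrow> (\<Sum>j\<in>\<pi> b. C $$ (i, j)) = M $$ (a, b)) \<and>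
        (u $ (l - 1) \<noteq> 0 \<longrightarrow> (\<Sum>j<n. C $$ (i, j)) = (\<Sum>c<l. M $$ (a, c)))"
      if "a < l" "i \<in> \<pi> a" for a i
    proof -
      let ?t = "\<lambda>b. (M $$ (a, b) - (\<Sum>j\<in>\<pi> b. C $$ (i, j))) * (u $ b - u $ (l - 1))"
      let ?s = "((\<Sum>c<l. M $$ (a, c)) - (\<Sum>j<n. C $$ (i, j))) * u $ (l - 1)"
      have t: "?t b \<ge> 0" if "b < l - 1" for b using blk root \<open>a < l\<close> \<open>i \<in> \<pi> a\<close> that by simp
      have s: "?s \<ge> 0" using row root that by simp
      have "(\<Sum>j<n. C $$ (i, j) * ?w j) = r * u $ a \<longleftrightarrow> (\<Sum>b<l - 1. ?t b) + ?s = 0"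
        using defect[of "\<lambda>b. M $$ (a, b)" "\<lambda>b. u $ b" "\<lambda>j. C $$ (i, j)"] Mu[OF that(1)] by auto
      also have "\<dots> \<longleftrightarrow> (\<Sum>b<l - 1. ?t b) = 0 \<and> ?s = 0"
        using t s by (intro add_nonneg_eq_0_iff sum_nonneg) auto
      also have "(\<Sum>b<l - 1. ?t b) = 0 \<longleftrightarrow> (\<forall>b<l - 1. ?t b = 0)"
        using t by (subst sum_nonneg_eq_0_iff) auto
      also have "\<dots> \<longleftrightarrow> (\<forall>b<l - 1. u $ b > u $ (l - 1) \<longrightarrow> (\<Sum>j\<in>\<pi> b. C $$ (i, j)) = M $$ (a, b))"
        using root(1) by (fastforce simp: less_le)
      also have "?s = 0 \<longleftrightarrow> (u $ (l - 1) \<noteq> 0 \<longrightarrow> (\<Sum>j<n. C $$ (i, j)) = (\<Sum>c<l. M $$ (a, c)))"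
        by auto
      finally show ?thesis .
    qed
    then have ab: "?ab \<longleftrightarrow> (\<forall>a<l. \<forall>i\<in>\<pi> a. (\<Sum>j<n. C $$ (i, j) * ?w j) = r * u $ a)" by blast
    show ?thesis
    proof
      assume "ereal ?\<rho> = largest_real_eigenvalue M"
      then have \<rho>: "?\<rho> = r" using r by (metis ereal.inject)
      show ?ab unfolding ab
      proof (intro allI impI ballI)
        fix a i assume a: "a < l" "i \<in> \<pi> a"
        have "(\<Sum>j<n. C $$ (i, j) * ?w j) = ?\<rho> * ?w i"
        proof (rule irreducible_supersolution_eigenvector[OF \<open>n > 0\<close> C nonneg irr _ wne])
          fix i assume "i < n"
          note i = block_index_less[OF part this]
          show "?w i \<ge> 0" using u0 i by blast
          show "(\<Sum>j<n. C $$ (i, j) * ?w j) \<le> ?\<rho> * ?w i" using Cw[OF i] \<rho> by simp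
        qed (use block_less[OF a] in auto)
        then show "(\<Sum>j<n. C $$ (i, j) * ?w j) = r * u $ a"
          using \<rho> block_index_eq[OF part a] by simp
      qed
    next
      assume ?ab
      \<comment> \<open>Under (a) and (b) the lift of \<open>u\<close> is an eigenvector of
        \<open>C\<close> for \<open>r\<close>, so \<open>r \<le> ?\<rho>\<close>; the opposite
        inequality is \<open>le\<close>.\<close>
      then have "(\<Sum>j<n. C $$ (i, j) * ?w j) = r * ?w i" if "i < n" for i
        using ab block_index_less[OF part that] by blast
      then have "eigenvalue C r" using eigenvalue_if_sums[OF C wne] by blast
      then have "r \<le> ?\<rho>" by (rule real_eigenvalue_le_spectral_radius[OF \<open>n > 0\<close> C])
      then show "ereal ?\<rho> = largest_real_eigenvalue M" using le r by (metis antisym ereal_less_eq(3))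
    qed
  qed
  ultimately show ?thesis by blast
qed

end
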